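(* Let $\alpha$ be an ordinal. The following are equivalent: (1) $\Delta(\alpha)$ holds; (2) $\nabla\alpha^\omega$ is halvable; (3) $\nabla\alpha^\omega$ is monotonically normal.
   Context: The ordinal $\alpha$ carries the order topology. $\square\alpha^\omega$ is $\alpha^\omega$ with base all $\prod_nU_n$, $U_n$ open in $\alpha$; $x\sim y$ iff $\{n:x(n)\neq y(n)\}$ is finite; $\nabla\alpha^\omega=\square\alpha^\omega/\sim$ with the quotient topology. Elements of $\nabla\alpha^\omega$ are denoted by representatives $x\in\alpha^\omega$; the notions below do not depend on representatives. $\mathrm{Lim}(\alpha)$ is the set of (nonzero) limit ordinals in $\alpha$; the other elements of $\alpha$ are isolated. $x,y\in\nabla\alpha^\omega$ switch if $x(n)<y(n)\in\mathrm{Lim}(\alpha)$ for infinitely many $n$, $y(n)<x(n)\in\mathrm{Lim}(\alpha)$ for infinitely many $n$, and $\{n\in\omega: x(n),y(n)\text{ are isolated and }x(n)\ne y(n)\}$ is finite. $\Delta(\alpha)$ is the statement: there is $F:\nabla\alpha^\omega\to\alpha^\omega$ such that if $x,y\in\nabla\alpha^\omega$ switch, then $y(n)<F(x)(n)<x(n)$ for infinitely many $n$ or $x(n)<F(y)(n)<y(n)$ for infinitely many $n$. A space is monotonically normal if to every point $x$ and open $U\ni x$ there is assigned an open $G(x,U)$ with $x\in G(x,U)\subseteq U$ such that $G(x,U)\cap G(y,V)\neq\emptyset$ implies $x\in V$ or $y\in U$. A neighbornet assigns to each point a neighborhood of it; a space is halvable if for every neighbornet $T$ there is a neighbornet $S$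 such that $S(x)\cap S(y)\ne\emptyset$ implies $x\in T(y)$ or $y\in T(x)$. *)

theory Defs
  imports "HOL-Analysis.Analysis"
begin

text \<open>An ordinal is rendered, as in \<open>HOL.BNF_Wellorder_Relation\<close>, by a well-order relation \<open>r\<close>,
  its elements being those of \<open>Field r\<close>; \<open>r\<close> may be empty (the ordinal 0).\<close>

abbreviation less_in :: "'a rel \<Rightarrow> 'a \<Rightarrow> 'a \<Rightarrow> bool" where
  "less_in r x y \<equiv> (x, y) \<in> r \<and> x \<noteq> y"

definition Lim :: "'a rel \<Rightarrow> 'a set" where
  "Lim r = {x \<in> Field r. (\<exists>y. less_in r y x) \<and>
                          (\<forall>y. less_in r y x \<longrightarrow> (\<exists>z. less_in r y z \<and> less_in r z x))}"

text \<open>\<open>Field r\<close> is among the generators because a one-point order has only empty open rays.\<close>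

definition order_top :: "'a rel \<Rightarrow> 'a topology" where
  "order_top r = topology_generated_by
     (insert (Field r) ((\<lambda>a. underS r a) ` Field r \<union> (\<lambda>a. aboveS r a) ` Field r))"

definition box_topology :: "('i \<Rightarrow> 'a topology) \<Rightarrow> 'i set \<Rightarrow> ('i \<Rightarrow> 'a) topology" where
  "box_topology T I = topology_generated_by {(\<Pi>\<^sub>E i\<in>I. U i) | U. \<forall>i\<in>I. openin (T i) (U i)}"

lemma openin_box_topology:
  "openin (box_topology T I) =
     arbitrary union_of (\<lambda>B. \<exists>U. B = (\<Pi>\<^sub>E i\<in>I. U i) \<and> (\<forall>i\<in>I. openin (T i) (U i)))"
proof -
  let ?P = "\<lambda>B. \<exists>U. B = (\<Pi>\<^sub>E i\<in>I. U i) \<and> (\<forall>i\<in>I. openin (T i) (U i))"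
  let ?B = "{(\<Pi>\<^sub>E i\<in>I. U i) | U. \<forall>i\<in>I. openin (T i) (U i)}"
  have int: "?P (A \<inter> B)" if "?P A" "?P B" for A B
    using that
  proof (elim exE conjE)
    fix U V assume U: "A = (\<Pi>\<^sub>E i\<in>I. U i)" "\<forall>i\<in>I. openin (T i) (U i)"
      and V: "B = (\<Pi>\<^sub>E i\<in>I. V i)" "\<forall>i\<in>I. openin (T i) (V i)"
    have "A \<inter> B = (\<Pi>\<^sub>E i\<in>I. U i \<inter> V i)"
      unfolding U V by (rule PiE_Int)
    moreover have "\<forall>i\<in>I. openin (T i) (U i \<inter> V i)"
      using U V by (simp add: openin_Int)
    ultimately show ?thesis by (intro exI[of _ "\<lambda>i. U i \<inter> V i"] conjI)
  qed
  have top: "istopology (arbitrary union_of ?P)"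
    by (rule istopology_base) (rule int)
  have gen: "generate_topology_on ?B S" if S: "(arbitrary union_of ?P) S" for S
  proof -
    obtain \<U> where U: "\<U> \<subseteq> ?B" "\<Union>\<U> = S"
      using S unfolding union_of_def by blast
    have "generate_topology_on ?B (\<Union>\<U>)"
    proof (rule generate_topology_on.UN)
      fix k assume "k \<in> \<U>"
      with U(1) show "generate_topology_on ?B k"
        by (intro generate_topology_on.Basis) (rule subsetD)
    qed
    then show ?thesis by (simp only: U)
  qed
  have base: "(arbitrary union_of ?P) s" if "s \<in> ?B" for s
    using that unfolding mem_Collect_eq by (rule arbitrary_union_of_inc)
  show ?thesis
  proof (rule ext, rule iffI)
    fix S assume "openin (box_topology T I) S"
    then have "generate_topology_on ?B S"
      unfolding box_topology_def openin_topology_generated_by_iff .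
    then show "(arbitrary union_of ?P) S"
      by (rule generate_topology_on_coarsest[OF top, rotated]) (rule base)
  next
    fix S assume "(arbitrary union_of ?P) S"
    then show "openin (box_topology T I) S"
      unfolding box_topology_def openin_topology_generated_by_iff by (rule gen)
  qed
qed

lemma topspace_box_topology: "topspace (box_topology T I) = (\<Pi>\<^sub>E i\<in>I. topspace (T i))"
proof
  show "topspace (box_topology T I) \<subseteq> (\<Pi>\<^sub>E i\<in>I. topspace (T i))"
    unfolding box_topology_def topology_generated_by_topspace
    by (auto simp: PiE_iff dest: openin_subset)
  have "openin (box_topology T I) (\<Pi>\<^sub>E i\<in>I. topspace (T i))"
    unfolding box_topology_def by (rule topology_generated_by_Basis) auto
  then show "(\<Pi>\<^sub>E i\<in>I. topspace (T i)) \<subseteq> topspace (box_topology T I)"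
    by (rule openin_subset)
qed

text \<open>The quotient of \<open>X\<close> by an equivalence relation \<open>R\<close> on \<open>topspace X\<close>; a set of classes is open
  iff its preimage under the quotient map, i.e. its union, is open.\<close>

definition quotient_topology :: "'a topology \<Rightarrow> 'a rel \<Rightarrow> 'a set topology" where
  "quotient_topology X R = topology (\<lambda>\<U>. \<U> \<subseteq> topspace X // R \<and> openin X (\<Union>\<U>))"

lemma openin_quotient_topology:
  assumes "equiv (topspace X) R"
  shows "openin (quotient_topology X R) \<U> \<longleftrightarrow> \<U> \<subseteq> topspace X // R \<and> openin X (\<Union>\<U>)"
proof -
  have "\<Union>(\<U> \<inter> \<V>) = \<Union>\<U> \<inter> \<Union>\<V>"
    if "\<U> \<subseteq> topspace X // R" "\<V> \<subseteq> topspace X // R" for \<U> \<V>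
  proof (intro equalityI subsetI)
    fix x assume "x \<in> \<Union>\<U> \<inter> \<Union>\<V>"
    then obtain A B where AB: "A \<in> \<U>" "x \<in> A" "B \<in> \<V>" "x \<in> B" by blast
    then have "A \<in> topspace X // R" "B \<in> topspace X // R" using that by auto
    then have "A = B" using quotient_disj[OF assms, of A B] AB by auto
    then show "x \<in> \<Union>(\<U> \<inter> \<V>)" using AB by blast
  qed blast
  moreover have "openin X (\<Union>(\<Union>\<K>))" if "\<forall>K\<in>\<K>. openin X (\<Union>K)" for \<K>
  proof -
    have "\<Union>(\<Union>\<K>) = \<Union>(Union ` \<K>)" by blast
    then show ?thesis using that by auto
  qed
  ultimately have "istopology (\<lambda>\<U>. \<U> \<subseteq> topspace X // R \<and> openin X (\<Union>\<U>))"
    unfolding istopology_def by (auto simp: subset_iff)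
  then show ?thesis by (simp add: quotient_topology_def)
qed

lemma topspace_quotient_topology:
  assumes "equiv (topspace X) R"
  shows "topspace (quotient_topology X R) = topspace X // R"
proof
  have "openin (quotient_topology X R) (topspace (quotient_topology X R))" by simp
  then show "topspace (quotient_topology X R) \<subseteq> topspace X // R"
    unfolding openin_quotient_topology[OF assms] by (rule conjunct1)
  have "openin (quotient_topology X R) (topspace X // R)"
    unfolding openin_quotient_topology[OF assms] Union_quotient[OF assms] by simp
  then show "topspace X // R \<subseteq> topspace (quotient_topology X R)"
    by (rule openin_subset)
qed

lemma quotient_map_quotient_topology:
  assumes "equiv (topspace X) R"
  shows "quotient_map X (quotient_topology X R) (\<lambda>x. R `` {x})"
proof -
  have "{x \<in> topspace X. R `` {x} \<in> \<U>} = \<Union>\<U>" if "\<U> \<subseteq> topspace X // R" for \<U>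
  proof -
    have "R `` {x} = C" if "C \<in> \<U>" "x \<in> C" for x C
      using that \<open>\<U> \<subseteq> _\<close> Image_singleton_iff assms by (metis (no_types, lifting) quotientE equiv_class_eq subsetD)
    moreover have "x \<in> topspace X" if "C \<in> \<U>" "x \<in> C" for x C
      using that \<open>\<U> \<subseteq> _\<close> Union_quotient[OF assms] by blast
    ultimately show ?thesis using equiv_class_self[OF assms] by blast
  qed
  moreover have "(\<lambda>x. R `` {x}) ` topspace X = topspace X // R"
    by (auto simp: quotient_def)
  ultimately show ?thesis
    unfolding quotient_map_def topspace_quotient_topology[OF assms]
    by (simp add: openin_quotient_topology[OF assms])
qed

definition seqs :: "'a rel \<Rightarrow> (nat \<Rightarrow> 'a) set" where
  "seqs r = UNIV \<rightarrow>\<^sub>E Field r"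

definition eq_fin :: "'a rel \<Rightarrow> (nat \<Rightarrow> 'a) rel" where
  "eq_fin r = {(x, y). x \<in> seqs r \<and> y \<in> seqs r \<and> finite {n. x n \<noteq> y n}}"

definition nabla :: "'a rel \<Rightarrow> (nat \<Rightarrow> 'a) set topology" where
  "nabla r = quotient_topology (box_topology (\<lambda>_. order_top r) UNIV) (eq_fin r)"

lemma topspace_order_top: "topspace (order_top r) = Field r"
  by (auto simp: order_top_def topology_generated_by_topspace underS_def aboveS_def Field_def)

lemma equiv_eq_fin: "equiv (seqs r) (eq_fin r)"
proof (rule equivI)
  show "refl_on (seqs r) (eq_fin r)" "eq_fin r \<subseteq> seqs r \<times> seqs r"
    by (auto simp: refl_on_def eq_fin_def)
  show "sym (eq_fin r)" by (auto simp: sym_def eq_fin_def eq_commute)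
  show "trans (eq_fin r)"
  proof (rule transI)
    fix x y z assume "(x, y) \<in> eq_fin r" "(y, z) \<in> eq_fin r"
    moreover have "{n. x n \<noteq> z n} \<subseteq> {n. x n \<noteq> y n} \<union> {n. y n \<noteq> z n}" by auto
    ultimately show "(x, z) \<in> eq_fin r"
      by (auto simp: eq_fin_def dest: finite_subset)
  qed
qed

lemma topspace_nabla: "topspace (nabla r) = seqs r // eq_fin r"
proof -
  have "topspace (box_topology (\<lambda>_::nat. order_top r) UNIV) = seqs r"
    by (simp only: topspace_box_topology topspace_order_top seqs_def)
  then show ?thesis
    using equiv_eq_fin[of r] unfolding nabla_def by (simp only: topspace_quotient_topology)
qed

definition switch :: "'a rel \<Rightarrow> (nat \<Rightarrow> 'a) \<Rightarrow> (nat \<Rightarrow> 'a) \<Rightarrow> bool" where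
  "switch r x y \<longleftrightarrow>
     infinite {n. less_in r (x n) (y n) \<and> y n \<in> Lim r} \<and>
     infinite {n. less_in r (y n) (x n) \<and> x n \<in> Lim r} \<and>
     finite {n. x n \<in> Field r - Lim r \<and> y n \<in> Field r - Lim r \<and> x n \<noteq> y n}"

lemma finite_cong_finite:
  assumes "finite {n. P n \<noteq> Q n}"
  shows "finite {n. P n} = finite {n. Q n}"
proof -
  have "{n. P n} \<subseteq> {n. Q n} \<union> {n. P n \<noteq> Q n}" "{n. Q n} \<subseteq> {n. P n} \<union> {n. P n \<noteq> Q n}"
    by auto
  then show ?thesis using assms finite_subset finite_UnI by metis
qed

lemma switch_cong:
  assumes "(x, x') \<in> eq_fin r" "(y, y') \<in> eq_fin r"
  shows "switch r x y = switch r x' y'"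
proof -
  have *: "finite {n. Q (x n) (y n)} = finite {n. Q (x' n) (y' n)}" for Q
  proof (rule finite_cong_finite)
    have "{n. Q (x n) (y n) \<noteq> Q (x' n) (y' n)} \<subseteq> {n. x n \<noteq> x' n} \<union> {n. y n \<noteq> y' n}"
      by (auto; metis)
    then show "finite {n. Q (x n) (y n) \<noteq> Q (x' n) (y' n)}"
      using assms by (auto simp: eq_fin_def dest: finite_subset)
  qed
  show ?thesis
    unfolding switch_def
    using *[of "\<lambda>a b. less_in r a b \<and> b \<in> Lim r"] *[of "\<lambda>a b. less_in r b a \<and> a \<in> Lim r"]
      *[of "\<lambda>a b. a \<in> Field r - Lim r \<and> b \<in> Field r - Lim r \<and> a \<noteq> b"]
    by simp
qed

text \<open>\<open>F\<close> is a function of classes; the points of \<open>nabla r\<close> are given by representatives \<open>x\<close>, \<open>y\<close>.\<close>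

definition Delta :: "'a rel \<Rightarrow> bool" where
  "Delta r \<longleftrightarrow>
     (\<exists>F. F \<in> topspace (nabla r) \<rightarrow> seqs r \<and>
        (\<forall>x\<in>seqs r. \<forall>y\<in>seqs r. switch r x y \<longrightarrow>
           infinite {n. less_in r (y n) (F (eq_fin r `` {x}) n) \<and>
                        less_in r (F (eq_fin r `` {x}) n) (x n)} \<or>
           infinite {n. less_in r (x n) (F (eq_fin r `` {y}) n) \<and>
                        less_in r (F (eq_fin r `` {y}) n) (y n)}))"

definition monotonically_normal :: "'a topology \<Rightarrow> bool" where
  "monotonically_normal X \<longleftrightarrow>
     (\<exists>G. (\<forall>x U. openin X U \<and> x \<in> U \<longrightarrow> openin X (G x U) \<and> x \<in> G x U \<and> G x U \<subseteq> U) \<and>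
          (\<forall>x U y V. openin X U \<and> x \<in> U \<and> openin X V \<and> y \<in> V \<and> G x U \<inter> G y V \<noteq> {} \<longrightarrow>
             x \<in> V \<or> y \<in> U))"

text \<open>Neighborhoods are not required to be open.\<close>

definition neighbornet :: "'a topology \<Rightarrow> ('a \<Rightarrow> 'a set) \<Rightarrow> bool" where
  "neighbornet X T \<longleftrightarrow>
     (\<forall>x\<in>topspace X. T x \<subseteq> topspace X \<and> (\<exists>U. openin X U \<and> x \<in> U \<and> U \<subseteq> T x))"

definition halvable :: "'a topology \<Rightarrow> bool" where
  "halvable X \<longleftrightarrow>
     (\<forall>T. neighbornet X T \<longrightarrow>
        (\<exists>S. neighbornet X S \<and>
           (\<forall>x\<in>topspace X. \<forall>y\<in>topspace X. S x \<inter> S y \<noteq> {} \<longrightarrow> x \<in> T y \<or> y \<in> T x)))"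

end

theory Submission
  imports Defs
begin

text \<open>Sending \<open>n\<close> to \<open>(g n, x n]\<close> if \<open>x n\<close> is a limit and to \<open>{x n}\<close> otherwise describes the basic
  neighborhoods of a point \<open>x\<close> of the nabla product, up to finitely many coordinates. If two such
  neighborhoods meet but neither centre lies in the given neighborhood of the other, then the
  centres switch. So a function \<open>F\<close> as in \<open>Delta\<close> yields a monotone normality operator: take
  \<open>g\<close> above \<open>F\<close> wherever \<open>F\<close> lies below \<open>x\<close>.

  Conversely, halve the neighbornet \<open>T x = {y. y \<le> x almost everywhere}\<close>. Two points that switch
  have disjoint halved neighborhoods. The coordinates at which one point is a limit and the other one
  is its successor satisfy this for a trivial reason, so halving is applied instead to the points
  obtained by replacing every successor of a limit by that limit.\<close>

section \<open>Monotonically normal spaces are halvable\<close>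

lemma monotonically_normal_imp_halvable:
  assumes "monotonically_normal X"
  shows "halvable X"
  unfolding halvable_def
proof (intro allI impI)
  fix T assume T: "neighbornet X T"
  obtain G where G: "\<And>x U. openin X U \<Longrightarrow> x \<in> U \<Longrightarrow> openin X (G x U) \<and> x \<in> G x U \<and> G x U \<subseteq> U"
    and GI: "\<And>x U y V. openin X U \<Longrightarrow> x \<in> U \<Longrightarrow> openin X V \<Longrightarrow> y \<in> V \<Longrightarrow> G x U \<inter> G y V \<noteq> {} \<Longrightarrow>
      x \<in> V \<or> y \<in> U"
    using assms unfolding monotonically_normal_def by metis
  obtain U where U: "\<And>x. x \<in> topspace X \<Longrightarrow> openin X (U x) \<and> x \<in> U x \<and> U x \<subseteq> T x"
    using T unfolding neighbornet_def by metis
  have "neighbornet X (\<lambda>x. G x (U x))"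
    unfolding neighbornet_def using G U openin_subset by (metis order_refl)
  moreover have "x \<in> T y \<or> y \<in> T x"
    if "x \<in> topspace X" "y \<in> topspace X" "G x (U x) \<inter> G y (U y) \<noteq> {}" for x y
    using GI[of "U x" x "U y" y] U that by blast
  ultimately show "\<exists>S. neighbornet X S \<and>
      (\<forall>x\<in>topspace X. \<forall>y\<in>topspace X. S x \<inter> S y \<noteq> {} \<longrightarrow> x \<in> T y \<or> y \<in> T x)"
    by (intro exI[of _ "\<lambda>x. G x (U x)"]) blast
qed

section \<open>Points of the nabla product and their representatives\<close>

lemma topspace_box_order_top: "topspace (box_topology (\<lambda>_::nat. order_top r) UNIV) = seqs r"
  by (simp only: topspace_box_topology topspace_order_top seqs_def)

lemma openin_nabla:
  "openin (nabla r) \<U> \<longleftrightarrow>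
    \<U> \<subseteq> seqs r // eq_fin r \<and> openin (box_topology (\<lambda>_. order_top r) UNIV) (\<Union>\<U>)"
  unfolding nabla_def using equiv_eq_fin[of r]
  by (subst openin_quotient_topology) (simp_all only: topspace_box_order_top)

lemma eq_fin_class_in_topspace: "x \<in> seqs r \<Longrightarrow> eq_fin r `` {x} \<in> topspace (nabla r)"
  unfolding topspace_nabla by (rule quotientI)

lemma nabla_class_rep:
  assumes "c \<in> topspace (nabla r)"
  obtains x where "x \<in> seqs r" "c = eq_fin r `` {x}"
  using assms unfolding topspace_nabla by (auto elim: quotientE)

lemma nabla_reps:
  obtains \<rho> where "\<And>c. c \<in> topspace (nabla r) \<Longrightarrow> \<rho> c \<in> seqs r \<and> c = eq_fin r `` {\<rho> c}"
proof -
  have "\<forall>c\<in>topspace (nabla r). \<exists>x. x \<in> seqs r \<and> c = eq_fin r `` {x}"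
    using nabla_class_rep by (intro ballI) blast
  then have "\<exists>\<rho>. \<forall>c\<in>topspace (nabla r). \<rho> c \<in> seqs r \<and> c = eq_fin r `` {\<rho> c}"
    by (rule bchoice)
  then show ?thesis using that by blast
qed

lemma eq_fin_class_eq_iff:
  assumes "x \<in> seqs r" "y \<in> seqs r"
  shows "eq_fin r `` {x} = eq_fin r `` {y} \<longleftrightarrow> (x, y) \<in> eq_fin r"
  using eq_equiv_class_iff[OF equiv_eq_fin assms] .

text \<open>Letting \<open>P\<close> depend on \<open>n\<close> allows it to mention further
  sequences, such as bounds or values of a function on classes, that stay fixed while the two
  representatives change.\<close>

lemma eq_fin_finite_cong:
  assumes "(x, x') \<in> eq_fin r" "(y, y') \<in> eq_fin r"
  shows "finite {n. P n (x n) (y n)} \<longleftrightarrow> finite {n. P n (x' n) (y' n)}"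
proof (rule finite_cong_finite)
  have "{n. P n (x n) (y n) \<noteq> P n (x' n) (y' n)} \<subseteq> {n. x n \<noteq> x' n} \<union> {n. y n \<noteq> y' n}"
    by (auto; metis)
  then show "finite {n. P n (x n) (y n) \<noteq> P n (x' n) (y' n)}"
    using assms by (auto simp: eq_fin_def dest: finite_subset)
qed

section \<open>Basic neighborhoods, and successors of limits\<close>

definition nbhd :: "'a rel \<Rightarrow> 'a \<Rightarrow> 'a \<Rightarrow> 'a set" where
  "nbhd r p a = insert p {z. p \<in> Lim r \<and> less_in r a z \<and> less_in r z p}"

definition bounds :: "'a rel \<Rightarrow> (nat \<Rightarrow> 'a) \<Rightarrow> (nat \<Rightarrow> 'a) \<Rightarrow> bool" where
  "bounds r g x \<longleftrightarrow> (\<forall>n. x n \<in> Lim r \<longrightarrow> less_in r (g n) (x n))"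

text \<open>Allowing finitely many exceptions makes this set a union of classes. It is therefore the
  full preimage of \<open>nabla_nbhd\<close>, and openness can be tested on it in the box
  topology.\<close>

definition seq_nbhd :: "'a rel \<Rightarrow> (nat \<Rightarrow> 'a) \<Rightarrow> (nat \<Rightarrow> 'a) \<Rightarrow> (nat \<Rightarrow> 'a) set" where
  "seq_nbhd r x g = {z \<in> seqs r. finite {n. z n \<notin> nbhd r (x n) (g n)}}"

definition nabla_nbhd :: "'a rel \<Rightarrow> (nat \<Rightarrow> 'a) \<Rightarrow> (nat \<Rightarrow> 'a) \<Rightarrow> (nat \<Rightarrow> 'a) set set" where
  "nabla_nbhd r x g = (\<lambda>z. eq_fin r `` {z}) ` seq_nbhd r x g"

definition covers :: "'a rel \<Rightarrow> 'a \<Rightarrow> 'a \<Rightarrow> bool" where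
  "covers r b p \<longleftrightarrow> less_in r b p \<and> (\<nexists>z. less_in r b z \<and> less_in r z p)"

text \<open>In a well-order an immediate predecessor is unique, so the choice is determined. Every
  other point is fixed, limits among them.\<close>

definition lim_down :: "'a rel \<Rightarrow> 'a \<Rightarrow> 'a" where
  "lim_down r p = (if \<exists>b. b \<in> Lim r \<and> covers r b p then SOME b. b \<in> Lim r \<and> covers r b p else p)"

lemma lim_in_Field: "p \<in> Lim r \<Longrightarrow> p \<in> Field r"
  by (simp add: Lim_def)

lemma seqs_iff: "x \<in> seqs r \<longleftrightarrow> (\<forall>n. x n \<in> Field r)"
  by (auto simp: seqs_def)

lemma lim_dense: "p \<in> Lim r \<Longrightarrow> less_in r a p \<Longrightarrow> \<exists>z. less_in r a z \<and> less_in r z p"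
  unfolding Lim_def by blast

lemma lim_ex_less: "p \<in> Lim r \<Longrightarrow> \<exists>a. less_in r a p"
  unfolding Lim_def by blast

lemma covers_not_lim: "covers r b p \<Longrightarrow> p \<notin> Lim r"
  unfolding covers_def using lim_dense by fast

lemma ex_covers: "p \<in> Field r \<Longrightarrow> p \<notin> Lim r \<Longrightarrow> less_in r a p \<Longrightarrow> \<exists>b. covers r b p"
  unfolding covers_def Lim_def by blast

lemma lim_down_cases:
  obtains "lim_down r p = p" "\<And>b. covers r b p \<Longrightarrow> b \<notin> Lim r"
  | "lim_down r p \<in> Lim r" "covers r (lim_down r p) p"
proof (cases "\<exists>b. b \<in> Lim r \<and> covers r b p")
  case True
  then have "lim_down r p \<in> Lim r \<and> covers r (lim_down r p) p"
    unfolding lim_down_def by (simp only: if_True) (rule someI_ex)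
  then show ?thesis using that(2) by blast
next
  case False
  then have "lim_down r p = p" unfolding lim_down_def by (rule if_not_P)
  with False show ?thesis using that(1) by blast
qed

lemma lim_down_in_Field: "p \<in> Field r \<Longrightarrow> lim_down r p \<in> Field r"
  by (rule lim_down_cases[of r p]) (auto dest: lim_in_Field)

lemma lim_down_lim: "p \<in> Lim r \<Longrightarrow> lim_down r p = p"
  by (rule lim_down_cases[of r p]) (auto dest: covers_not_lim)

lemma nbhd_self: "p \<in> nbhd r p a"
  by (simp add: nbhd_def)

lemma nbhd_subset_Field: "p \<in> Field r \<Longrightarrow> nbhd r p a \<subseteq> Field r"
  by (auto simp: nbhd_def Field_def)

lemma bounds_exists: "\<exists>g. bounds r g x"
proof -
  have "\<forall>n. \<exists>a. x n \<in> Lim r \<longrightarrow> less_in r a (x n)" using lim_ex_less by fast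
  then show ?thesis unfolding bounds_def by (rule choice)
qed

lemma self_in_nabla_nbhd: "x \<in> seqs r \<Longrightarrow> eq_fin r `` {x} \<in> nabla_nbhd r x g"
  by (auto simp: nabla_nbhd_def seq_nbhd_def nbhd_self)

lemma seq_nbhd_saturated:
  assumes "z \<in> seq_nbhd r x g" "(z, z') \<in> eq_fin r"
  shows "z' \<in> seq_nbhd r x g"
proof -
  have "finite {n. z n \<notin> nbhd r (x n) (g n)} \<longleftrightarrow> finite {n. z' n \<notin> nbhd r (x n) (g n)}"
    using eq_fin_finite_cong[OF assms(2) assms(2), of "\<lambda>n a b. a \<notin> nbhd r (x n) (g n)"] .
  then show ?thesis using assms by (auto simp: seq_nbhd_def eq_fin_def)
qed

lemma Union_nabla_nbhd: "\<Union>(nabla_nbhd r x g) = seq_nbhd r x g"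
proof
  show "\<Union>(nabla_nbhd r x g) \<subseteq> seq_nbhd r x g"
    by (auto simp: nabla_nbhd_def intro: seq_nbhd_saturated)
  show "seq_nbhd r x g \<subseteq> \<Union>(nabla_nbhd r x g)"
    by (auto simp: nabla_nbhd_def seq_nbhd_def eq_fin_def)
qed

lemma in_nabla_nbhd_iff:
  assumes "z \<in> seqs r"
  shows "eq_fin r `` {z} \<in> nabla_nbhd r x g \<longleftrightarrow> z \<in> seq_nbhd r x g"
proof
  assume "eq_fin r `` {z} \<in> nabla_nbhd r x g"
  moreover have "z \<in> eq_fin r `` {z}" using assms by (auto simp: eq_fin_def)
  ultimately show "z \<in> seq_nbhd r x g" using Union_nabla_nbhd by blast
qed (simp add: nabla_nbhd_def)

text \<open>Membership in both sets can fail at only finitely many coordinates, so a common class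
  forces the factors to meet almost everywhere. Conversely, choosing a common point wherever the
  factors meet, and \<open>x n\<close> elsewhere, gives a representative of a common class.\<close>

lemma nabla_nbhd_meet_iff:
  assumes x: "x \<in> seqs r" and y: "y \<in> seqs r"
  shows "nabla_nbhd r x g \<inter> nabla_nbhd r y h \<noteq> {} \<longleftrightarrow>
    finite {n. nbhd r (x n) (g n) \<inter> nbhd r (y n) (h n) = {}}" (is "?L \<longleftrightarrow> finite ?E")
proof
  assume ?L
  then obtain c where c: "c \<in> nabla_nbhd r x g" "c \<in> nabla_nbhd r y h" by blast
  then obtain z where z: "z \<in> seq_nbhd r x g" "c = eq_fin r `` {z}" by (auto simp: nabla_nbhd_def)
  then have "z \<in> seqs r" by (simp add: seq_nbhd_def)
  with z c have "z \<in> seq_nbhd r y h" using in_nabla_nbhd_iff by metis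
  with z(1) have "finite ({n. z n \<notin> nbhd r (x n) (g n)} \<union> {n. z n \<notin> nbhd r (y n) (h n)})"
    by (simp add: seq_nbhd_def)
  then show "finite ?E" by (rule rev_finite_subset) blast
next
  assume E: "finite ?E"
  define z where "z n = (if n \<in> ?E then x n else SOME w. w \<in> nbhd r (x n) (g n) \<inter> nbhd r (y n) (h n))"
    for n
  have *: "z n \<in> nbhd r (x n) (g n) \<inter> nbhd r (y n) (h n)" if "n \<notin> ?E" for n
  proof -
    have "\<exists>w. w \<in> nbhd r (x n) (g n) \<inter> nbhd r (y n) (h n)" using that by blast
    then show ?thesis unfolding z_def if_not_P[OF that] by (rule someI_ex)
  qed
  have F: "z n \<in> Field r" for n
  proof (cases "n \<in> ?E")
    case True
    then show ?thesis using x by (simp add: z_def seqs_iff)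
  next
    case False
    then show ?thesis using *[OF False] nbhd_subset_Field[of "x n" r "g n"] x by (auto simp: seqs_iff)
  qed
  have "{n. z n \<notin> nbhd r (x n) (g n)} \<subseteq> ?E" "{n. z n \<notin> nbhd r (y n) (h n)} \<subseteq> ?E"
    using * by blast+
  then have "z \<in> seq_nbhd r x g" "z \<in> seq_nbhd r y h"
    using E F by (auto simp: seq_nbhd_def seqs_iff dest: finite_subset)
  then show ?L unfolding nabla_nbhd_def by blast
qed

section \<open>Well-orders and their order topology\<close>

context
  fixes r :: "'a rel"
  assumes wo: "Well_order r"
begin

lemma lt_trans: "less_in r x y \<Longrightarrow> less_in r y z \<Longrightarrow> less_in r x z"
  using wo unfolding well_order_on_def linear_order_on_def partial_order_on_def preorder_on_def
  by (metis antisymD transD)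

lemma lt_asym: "less_in r x y \<Longrightarrow> \<not> less_in r y x"
  using wo unfolding well_order_on_def linear_order_on_def partial_order_on_def
  by (metis antisymD)

lemma lt_linear: "x \<in> Field r \<Longrightarrow> y \<in> Field r \<Longrightarrow> less_in r x y \<or> x = y \<or> less_in r y x"
  using wo unfolding well_order_on_def linear_order_on_def total_on_def by blast

lemma lt_Field: "less_in r x y \<Longrightarrow> x \<in> Field r" "less_in r x y \<Longrightarrow> y \<in> Field r"
  by (auto simp: Field_def)

lemma le_refl: "x \<in> Field r \<Longrightarrow> (x, x) \<in> r"
  using wo unfolding well_order_on_def linear_order_on_def partial_order_on_def preorder_on_def
  by (auto dest: refl_onD)

text \<open>The points up to \<open>p\<close> are those below the successor of \<open>p\<close>, an
  open ray, or the whole space if \<open>p\<close> is the maximum.\<close>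

lemma openin_below:
  assumes p: "p \<in> Field r"
  shows "openin (order_top r) {z \<in> Field r. \<not> less_in r p z}"
proof (cases "\<exists>s. less_in r p s")
  case True
  interpret wo_rel r using wo by (simp add: wo_rel_def)
  define s where "s = suc {p}"
  have ne: "AboveS {p} \<noteq> {}" using True by (auto simp: AboveS_def Field_def)
  have s: "less_in r p s" "s \<in> Field r"
    using suc_AboveS[of "{p}"] p ne unfolding s_def AboveS_def by auto
  have le: "(s, z) \<in> r" if "less_in r p z" for z
    using suc_least_AboveS[of z "{p}"] that unfolding s_def AboveS_def by (auto simp: Field_def)
  have "{z \<in> Field r. \<not> less_in r p z} = Order_Relation.underS r s"
  proof (intro equalityI subsetI)
    fix z assume "z \<in> {z \<in> Field r. \<not> less_in r p z}"
    then have "less_in r z s" using lt_linear[of z s] lt_linear[of z p] s lt_trans by blast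
    then show "z \<in> Order_Relation.underS r s" by (simp add: underS_def)
  next
    fix z assume "z \<in> Order_Relation.underS r s"
    then have z: "less_in r z s" by (simp add: underS_def)
    then have "\<not> less_in r p z" using le lt_asym by metis
    then show "z \<in> {z \<in> Field r. \<not> less_in r p z}" using lt_Field(1)[OF z] by blast
  qed
  moreover have "openin (order_top r) (Order_Relation.underS r s)"
    unfolding order_top_def using s by (intro topology_generated_by_Basis) blast
  ultimately show ?thesis by simp
next
  case False
  then have "{z \<in> Field r. \<not> less_in r p z} = topspace (order_top r)"
    by (auto simp: topspace_order_top)
  then show ?thesis by (simp only: openin_topspace)
qed

lemma openin_above: "a \<in> Field r \<Longrightarrow> openin (order_top r) {z. less_in r a z}"
proof -
  assume a: "a \<in> Field r"
  have "{z. less_in r a z} = aboveS r a" by (auto simp: aboveS_def)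
  moreover have "openin (order_top r) (aboveS r a)"
    unfolding order_top_def using a by (intro topology_generated_by_Basis) blast
  ultimately show ?thesis by simp
qed

text \<open>At a limit this is the intersection of an open upper ray with the open set of points up
  to \<open>p\<close>. An isolated \<open>p\<close> is cut out in the same way using its immediate
  predecessor, or it is the least element and equals its own lower set.\<close>

lemma openin_nbhd:
  assumes p: "p \<in> Field r" and a: "p \<in> Lim r \<Longrightarrow> less_in r a p"
  shows "openin (order_top r) (nbhd r p a)"
proof -
  let ?D = "{z \<in> Field r. \<not> less_in r p z}"
  have between: "openin (order_top r) ({z. less_in r b z} \<inter> ?D)" if "less_in r b p" for b
    using that by (intro openin_Int openin_above openin_below p) (rule lt_Field)
  show ?thesis
  proof (cases "p \<in> Lim r")
    case True
    have "nbhd r p a = {z. less_in r a z} \<inter> ?D"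
      using True a p lt_linear[OF p] lt_asym lt_Field unfolding nbhd_def by blast
    then show ?thesis using between a True by simp
  next
    case False
    then have n: "nbhd r p a = {p}" by (auto simp: nbhd_def)
    show ?thesis
    proof (cases "\<exists>b. less_in r b p")
      case True
      then obtain b where b: "covers r b p" using ex_covers[OF p False] by blast
      have "{p} = {z. less_in r b z} \<inter> ?D"
        using b p lt_linear[OF p] unfolding covers_def by blast
      then show ?thesis using between b n by (simp add: covers_def)
    next
      case False
      then have "{p} = ?D" using p lt_linear[OF p] by blast
      then show ?thesis using openin_below[OF p] n by simp
    qed
  qed
qed

lemma nbhd_mono:
  assumes "less_in r a b"
  shows "nbhd r p b \<subseteq> nbhd r p a"
  unfolding nbhd_def using lt_trans[OF assms] by blast

text \<open>Induction on the generation of \<open>U\<close>. At an isolated point the neighborhood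
  is a singleton. At a limit an intersection is handled by the larger of the two bounds. A lower ray
  containing \<open>p\<close> allows any bound below \<open>p\<close>, while an upper ray supplies
  its own endpoint as the bound.\<close>

lemma openin_imp_nbhd:
  assumes "openin (order_top r) U" "p \<in> U"
  shows "\<exists>a. (p \<in> Lim r \<longrightarrow> less_in r a p) \<and> nbhd r p a \<subseteq> U"
proof -
  have "generate_topology_on
      (insert (Field r) ((\<lambda>a. underS r a) ` Field r \<union> (\<lambda>a. aboveS r a) ` Field r)) U"
    using assms(1) unfolding order_top_def openin_topology_generated_by_iff .
  then show ?thesis using assms(2)
  proof induction
    case (Int A B)
    then obtain a b where ab: "p \<in> Lim r \<longrightarrow> less_in r a p" "nbhd r p a \<subseteq> A"
      "p \<in> Lim r \<longrightarrow> less_in r b p" "nbhd r p b \<subseteq> B" by blast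
    show ?case
    proof (cases "p \<in> Lim r")
      case True
      then have "less_in r a b \<or> a = b \<or> less_in r b a" using lt_linear ab lt_Field by metis
      then show ?thesis using ab nbhd_mono[of a b p] nbhd_mono[of b a p] by blast
    next
      case False
      then show ?thesis using Int.prems by (auto simp: nbhd_def)
    qed
  next
    case (UN K)
    then show ?case by blast
  next
    case (Basis S)
    show ?case
    proof (cases "p \<in> Lim r")
      case False
      then show ?thesis using Basis.prems by (auto simp: nbhd_def)
    next
      case True
      obtain b where b: "less_in r b p" using lim_ex_less[OF True] by (elim exE)
      from Basis.hyps consider "S = Field r" | a where "S = underS r a" | a where "S = aboveS r a"
        by blast
      then show ?thesis
      proof cases
        case 1
        then show ?thesis using b nbhd_subset_Field[of p r b] Basis.prems by blast
      next
        case (2 a)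
        then have "less_in r p a" using Basis.prems by (simp add: underS_def)
        then have "nbhd r p b \<subseteq> S" unfolding 2 nbhd_def underS_def using lt_trans by blast
        then show ?thesis using b by blast
      next
        case (3 a)
        then have a: "less_in r a p" using Basis.prems by (auto simp: aboveS_def)
        then have "nbhd r p a \<subseteq> S" unfolding 3 nbhd_def aboveS_def by blast
        then show ?thesis using a by blast
      qed
    qed
  qed simp
qed

text \<open>Neighborhoods extend only downwards: a common point is at most \<open>q\<close>, hence
  differs from \<open>p\<close> and lies in the interval below \<open>p\<close>. So the smaller
  centre belongs to the neighborhood of the larger one.\<close>

lemma nbhd_meet:
  assumes "nbhd r p a \<inter> nbhd r q b \<noteq> {}" "less_in r q p"
  shows "p \<in> Lim r" "less_in r a q"
proof -
  obtain w where w: "w \<in> nbhd r p a" "w \<in> nbhd r q b" using assms by blast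
  from w(2) have wq: "w = q \<or> less_in r w q" by (auto simp: nbhd_def)
  then have "w \<noteq> p" using assms(2) lt_asym by blast
  with w(1) have "p \<in> Lim r" "less_in r a w" by (auto simp: nbhd_def)
  then show "p \<in> Lim r" "less_in r a q" using wq lt_trans by blast+
qed

section \<open>Basic neighborhoods in the nabla topology\<close>

lemma openin_nabla_nbhd:
  assumes x: "x \<in> seqs r" and g: "bounds r g x"
  shows "openin (nabla r) (nabla_nbhd r x g)"
proof -
  have op: "openin (order_top r) (nbhd r (x n) (g n))" for n
    using x g by (intro openin_nbhd) (auto simp: seqs_iff bounds_def)
  have "openin (box_topology (\<lambda>_. order_top r) UNIV) (seq_nbhd r x g)"
  proof (subst openin_subopen, intro ballI)
    fix z assume z: "z \<in> seq_nbhd r x g"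
    \<comment> \<open>A box around \<open>z\<close>: at the finitely many exceptional coordinates of
      \<open>z\<close> the factor is the whole order, so every point of the box has its exceptions
      among those of \<open>z\<close>.\<close>
    define U where "U n = (if z n \<in> nbhd r (x n) (g n) then nbhd r (x n) (g n) else Field r)" for n
    have "openin (order_top r) (U n)" for n
      using op openin_topspace[of "order_top r"] by (simp add: U_def topspace_order_top)
    then have "openin (box_topology (\<lambda>_::nat. order_top r) UNIV) (\<Pi>\<^sub>E n\<in>UNIV. U n)"
      unfolding box_topology_def by (intro topology_generated_by_Basis) blast
    moreover have "z \<in> (\<Pi>\<^sub>E n\<in>UNIV. U n)"
      using z by (auto simp: U_def seq_nbhd_def seqs_iff)
    moreover have "(\<Pi>\<^sub>E n\<in>UNIV. U n) \<subseteq> seq_nbhd r x g"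
    proof
      fix w assume w: "w \<in> (\<Pi>\<^sub>E n\<in>UNIV. U n)"
      then have wU: "w n \<in> U n" for n by auto
      have "U n \<subseteq> Field r" for n
        using nbhd_subset_Field[of "x n" r "g n"] x by (auto simp: U_def seqs_iff)
      then have "w \<in> seqs r" using wU by (auto simp: seqs_iff)
      moreover have "{n. w n \<notin> nbhd r (x n) (g n)} \<subseteq> {n. z n \<notin> nbhd r (x n) (g n)}"
        using wU by (auto simp: U_def split: if_splits) metis
      then have "finite {n. w n \<notin> nbhd r (x n) (g n)}"
        using z by (auto simp: seq_nbhd_def dest: finite_subset)
      ultimately show "w \<in> seq_nbhd r x g" by (simp add: seq_nbhd_def)
    qed
    ultimately show "\<exists>W. openin (box_topology (\<lambda>_. order_top r) UNIV) W \<and> z \<in> W \<and> W \<subseteq> seq_nbhd r x g"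
      by blast
  qed
  then show ?thesis
    unfolding openin_nabla Union_nabla_nbhd
    by (auto simp: nabla_nbhd_def seq_nbhd_def intro: quotientI)
qed

lemma openin_nabla_imp_nbhd:
  assumes U: "openin (nabla r) U" and xU: "eq_fin r `` {x} \<in> U" and x: "x \<in> seqs r"
  shows "\<exists>g. bounds r g x \<and> nabla_nbhd r x g \<subseteq> U"
proof -
  have "x \<in> \<Union>U" using xU equiv_class_self[OF equiv_eq_fin x] by blast
  moreover have "(arbitrary union_of (\<lambda>B. \<exists>V. B = (\<Pi>\<^sub>E i\<in>(UNIV::nat set). V i) \<and>
      (\<forall>i\<in>UNIV. openin (order_top r) (V i)))) (\<Union>U)"
    using U unfolding openin_nabla openin_box_topology by blast
  ultimately obtain B where B: "\<exists>V. B = (\<Pi>\<^sub>E i\<in>UNIV. V i) \<and> (\<forall>i\<in>UNIV. openin (order_top r) (V i))"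
      "x \<in> B" "B \<subseteq> \<Union>U"
    unfolding arbitrary_union_of_alt by meson
  from B(1) obtain V where BV: "B = (\<Pi>\<^sub>E i\<in>UNIV. V i) \<and> (\<forall>i\<in>UNIV. openin (order_top r) (V i))"
    by (elim exE)
  then have V: "x \<in> (\<Pi>\<^sub>E n\<in>UNIV. V n)" "(\<Pi>\<^sub>E n\<in>UNIV. V n) \<subseteq> \<Union>U"
      "openin (order_top r) (V i)" for i
    using B by simp_all
  have "\<forall>n. \<exists>a. (x n \<in> Lim r \<longrightarrow> less_in r a (x n)) \<and> nbhd r (x n) a \<subseteq> V n"
    using PiE_mem[OF V(1)] V(3) by (intro allI openin_imp_nbhd) simp_all
  then obtain g where g: "\<And>n. x n \<in> Lim r \<longrightarrow> less_in r (g n) (x n)" "\<And>n. nbhd r (x n) (g n) \<subseteq> V n"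
    by metis
  have "eq_fin r `` {z} \<in> U" if z: "z \<in> seq_nbhd r x g" for z
  proof -
    \<comment> \<open>Correcting \<open>z\<close> at its finitely many exceptions moves it into the
      box without changing its class.\<close>
    define w where "w n = (if z n \<in> nbhd r (x n) (g n) then z n else x n)" for n
    have "w n \<in> V n" for n using PiE_mem[OF V(1)] g(2)[of n] by (auto simp: w_def)
    then have "w \<in> (\<Pi>\<^sub>E n\<in>UNIV. V n)" by auto
    then have "w \<in> \<Union>U" using V(2) by blast
    have "{n. z n \<noteq> w n} \<subseteq> {n. z n \<notin> nbhd r (x n) (g n)}" by (auto simp: w_def)
    then have zw: "(z, w) \<in> eq_fin r"
      using z x by (auto simp: eq_fin_def seq_nbhd_def seqs_iff w_def dest: finite_subset)
    from \<open>w \<in> \<Union>U\<close> obtain c where c: "c \<in> U" "w \<in> c" by blast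
    have "c \<in> seqs r // eq_fin r" using c U unfolding openin_nabla by blast
    then have "c = eq_fin r `` {w}"
      using c equiv_eq_fin[of r] by (metis Image_singleton_iff equiv_class_eq quotientE)
    also have "\<dots> = eq_fin r `` {z}" using equiv_class_eq[OF equiv_eq_fin zw] by simp
    finally show ?thesis using c by simp
  qed
  then have "nabla_nbhd r x g \<subseteq> U" by (auto simp: nabla_nbhd_def)
  then show ?thesis using g(1) unfolding bounds_def by blast
qed

section \<open>From \<open>Delta\<close> to monotone normality\<close>

text \<open>Consider a coordinate where \<open>x n\<close> misses the neighborhood of
  \<open>y n\<close> although the neighborhoods of the two points meet. If \<open>x n\<close> were
  the smaller centre, \<open>nbhd_meet\<close> would put it into the neighborhood of
  \<open>y n\<close>. So it is the larger one, and \<open>nbhd_meet\<close> makes it a limit.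
  Applied in both directions, this gives the two infinite sets required by
  \<open>switch\<close>.\<close>

lemma infinite_below_if_not_in_seq_nbhd:
  assumes x: "x \<in> seqs r" and y: "y \<in> seqs r" and nx: "x \<notin> seq_nbhd r y h"
    and sub: "\<And>n. nbhd r (y n) (h' n) \<subseteq> nbhd r (y n) (h n)"
    and meet: "finite {n. nbhd r (x n) (g n) \<inter> nbhd r (y n) (h' n) = {}}" (is "finite ?E")
  shows "infinite {n. less_in r (y n) (x n) \<and> x n \<in> Lim r}" (is "infinite ?A")
proof
  assume A: "finite ?A"
  have "{n. x n \<notin> nbhd r (y n) (h n)} \<subseteq> ?A \<union> ?E"
  proof
    fix n assume "n \<in> {n. x n \<notin> nbhd r (y n) (h n)}"
    then have n: "x n \<notin> nbhd r (y n) (h' n)" using sub by blast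
    show "n \<in> ?A \<union> ?E"
    proof (cases "n \<in> ?E")
      case False
      then have m: "nbhd r (x n) (g n) \<inter> nbhd r (y n) (h' n) \<noteq> {}" by blast
      have "x n \<noteq> y n" using n nbhd_self by metis
      moreover have "\<not> less_in r (x n) (y n)"
      proof
        assume l: "less_in r (x n) (y n)"
        then have "y n \<in> Lim r" "less_in r (h' n) (x n)"
          using nbhd_meet[of "y n" "h' n" "x n" "g n"] m by blast+
        then have "x n \<in> nbhd r (y n) (h' n)" using l by (simp add: nbhd_def)
        then show False using n by simp
      qed
      ultimately have "less_in r (y n) (x n)" using lt_linear x y by (metis seqs_iff)
      then show ?thesis using nbhd_meet(1)[OF m] by blast
    qed simp
  qed
  then have "finite {n. x n \<notin> nbhd r (y n) (h n)}" using A meet by (auto dest: finite_subset)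
  then show False using nx x by (simp add: seq_nbhd_def)
qed

lemma Delta_imp_monotonically_normal:
  assumes "Delta r"
  shows "monotonically_normal (nabla r)"
proof -
  obtain F where F: "\<And>x y. x \<in> seqs r \<Longrightarrow> y \<in> seqs r \<Longrightarrow> switch r x y \<Longrightarrow>
      infinite {n. less_in r (y n) (F (eq_fin r `` {x}) n) \<and> less_in r (F (eq_fin r `` {x}) n) (x n)} \<or>
      infinite {n. less_in r (x n) (F (eq_fin r `` {y}) n) \<and> less_in r (F (eq_fin r `` {y}) n) (y n)}"
    using assms unfolding Delta_def by blast
  \<comment> \<open>Bounds need sequences, whereas \<open>F\<close> and the operator
    \<open>G\<close> take classes, so one representative is fixed for each class.\<close>
  obtain \<rho> where \<rho>: "\<And>c. c \<in> topspace (nabla r) \<Longrightarrow> \<rho> c \<in> seqs r \<and> c = eq_fin r `` {\<rho> c}"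
    by (rule nabla_reps) blast
  define good where "good c U \<longleftrightarrow> openin (nabla r) U \<and> c \<in> U" for c U
  have top: "c \<in> topspace (nabla r)" if "good c U" for c U
    using that openin_subset unfolding good_def by blast
  have "\<exists>g. bounds r g (\<rho> c) \<and> nabla_nbhd r (\<rho> c) g \<subseteq> U" if "good c U" for c U
    using openin_nabla_imp_nbhd[of U "\<rho> c"] \<rho>[OF top[OF that]] that by (auto simp: good_def)
  then obtain g where g: "\<And>c U. good c U \<Longrightarrow> bounds r (g c U) (\<rho> c) \<and> nabla_nbhd r (\<rho> c) (g c U) \<subseteq> U"
    by metis
  \<comment> \<open>The bound is raised to \<open>F c n\<close> when that shrinks the neighborhood
    and still leaves a bound below the centre.\<close>
  define m where "m c U n =
    (if less_in r (g c U n) (F c n) \<and> less_in r (F c n) (\<rho> c n) then F c n else g c U n)" for c U n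
  have mb: "bounds r (m c U) (\<rho> c)" if "good c U" for c U
    using g[OF that] by (auto simp: bounds_def m_def)
  have msub: "nbhd r (\<rho> c n) (m c U n) \<subseteq> nbhd r (\<rho> c n) (g c U n)" for c U n
    unfolding m_def using nbhd_mono by (cases "less_in r (g c U n) (F c n) \<and> less_in r (F c n) (\<rho> c n)") auto
  \<comment> \<open>The coordinates at which \<open>F c\<close> lies strictly between the
    representatives have disjoint neighborhoods. If the neighborhoods met there, the bound
    \<open>m c U n\<close> would be below \<open>F c n\<close>, but \<open>m\<close> would then have
    been raised to \<open>F c n\<close>.\<close>
  have separated: "finite {n. less_in r (\<rho> d n) (F c n) \<and> less_in r (F c n) (\<rho> c n)}"
    if c: "good c U" and d: "good d V"
      and fin: "finite {n. nbhd r (\<rho> c n) (m c U n) \<inter> nbhd r (\<rho> d n) (m d V n) = {}}" for c d U V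
  proof (rule finite_subset[OF _ fin], rule subsetI, rule CollectI, rule ccontr)
    fix n
    assume "n \<in> {n. less_in r (\<rho> d n) (F c n) \<and> less_in r (F c n) (\<rho> c n)}"
      and meet: "nbhd r (\<rho> c n) (m c U n) \<inter> nbhd r (\<rho> d n) (m d V n) \<noteq> {}"
    then have n: "less_in r (\<rho> d n) (F c n)" "less_in r (F c n) (\<rho> c n)" by auto
    then have "less_in r (\<rho> d n) (\<rho> c n)" using lt_trans by blast
    from nbhd_meet[OF meet this] have l: "\<rho> c n \<in> Lim r" "less_in r (m c U n) (\<rho> d n)" .
    then have mF: "less_in r (m c U n) (F c n)" using n lt_trans by blast
    then have "m c U n = g c U n" by (auto simp: m_def split: if_splits)
    then have "m c U n = F c n" using mF n(2) by (simp add: m_def)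
    then show False using mF by simp
  qed
  define G where "G c U = nabla_nbhd r (\<rho> c) (m c U)" for c U
  have "openin (nabla r) (G c U) \<and> c \<in> G c U \<and> G c U \<subseteq> U" if cU: "good c U" for c U
  proof (intro conjI)
    note p = \<rho>[OF top[OF cU]]
    show "openin (nabla r) (G c U)" unfolding G_def using p mb[OF cU] by (intro openin_nabla_nbhd) auto
    show "c \<in> G c U" unfolding G_def using p self_in_nabla_nbhd by metis
    have "seq_nbhd r (\<rho> c) (m c U) \<subseteq> seq_nbhd r (\<rho> c) (g c U)"
    proof
      fix z assume z: "z \<in> seq_nbhd r (\<rho> c) (m c U)"
      have "{n. z n \<notin> nbhd r (\<rho> c n) (g c U n)} \<subseteq> {n. z n \<notin> nbhd r (\<rho> c n) (m c U n)}"
        using msub by blast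
      with z show "z \<in> seq_nbhd r (\<rho> c) (g c U)" by (auto simp: seq_nbhd_def dest: finite_subset)
    qed
    then have "G c U \<subseteq> nabla_nbhd r (\<rho> c) (g c U)" unfolding G_def nabla_nbhd_def by (rule image_mono)
    then show "G c U \<subseteq> U" using g[OF cU] by blast
  qed
  moreover have "c \<in> V \<or> d \<in> U" if cU: "good c U" and dV: "good d V" and I: "G c U \<inter> G d V \<noteq> {}" for c U d V
  proof (rule ccontr)
    assume neg: "\<not> (c \<in> V \<or> d \<in> U)"
    note c = \<rho>[OF top[OF cU]] and d = \<rho>[OF top[OF dV]]
    have nin: "\<rho> c \<notin> seq_nbhd r (\<rho> d) (g d V)" "\<rho> d \<notin> seq_nbhd r (\<rho> c) (g c U)"
      using neg g[OF cU] g[OF dV] c d in_nabla_nbhd_iff by (metis subsetD)+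
    have fin: "finite {n. nbhd r (\<rho> c n) (m c U n) \<inter> nbhd r (\<rho> d n) (m d V n) = {}}"
      using I c d nabla_nbhd_meet_iff unfolding G_def by blast
    then have fin': "finite {n. nbhd r (\<rho> d n) (m d V n) \<inter> nbhd r (\<rho> c n) (m c U n) = {}}"
      by (simp add: Int_commute)
    have "infinite {n. less_in r (\<rho> d n) (\<rho> c n) \<and> \<rho> c n \<in> Lim r}"
      using infinite_below_if_not_in_seq_nbhd[OF _ _ nin(1) msub fin] c d by blast
    moreover have "infinite {n. less_in r (\<rho> c n) (\<rho> d n) \<and> \<rho> d n \<in> Lim r}"
      using infinite_below_if_not_in_seq_nbhd[OF _ _ nin(2) msub fin'] c d by blast
    \<comment> \<open>Neighborhoods of isolated points are singletons, so distinct isolated values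
      occur only where the neighborhoods are disjoint.\<close>
    moreover have "finite {n. \<rho> c n \<in> Field r - Lim r \<and> \<rho> d n \<in> Field r - Lim r \<and> \<rho> c n \<noteq> \<rho> d n}"
      by (rule finite_subset[OF _ fin]) (auto simp: nbhd_def)
    ultimately have "switch r (\<rho> c) (\<rho> d)" unfolding switch_def by blast
    then show False
      using F[of "\<rho> c" "\<rho> d"] c d separated[OF cU dV fin] separated[OF dV cU fin'] by auto
  qed
  ultimately show ?thesis
    unfolding monotonically_normal_def good_def by (intro exI[of _ G]) blast
qed

section \<open>From halvability to \<open>Delta\<close>\<close>

text \<open>The coordinatewise source of the function for \<open>Delta\<close>: \<open>f\<close> is
  prescribed from \<open>p\<close> and the bound \<open>a\<close> alone, yet it separates
  \<open>p\<close> from every such \<open>q\<close>. If \<open>lim_down r p\<close> is a limit,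
  disjointness pushes \<open>lim_down r q\<close> down to \<open>a\<close> or below. Otherwise
  \<open>p\<close> is isolated, \<open>niso\<close> makes \<open>q\<close> a limit, and the
  immediate predecessor of \<open>p\<close>, not being a limit, lies strictly above
  \<open>q\<close>.\<close>

lemma gap_from_disjoint:
  assumes p: "p \<in> Field r" and q: "q \<in> Field r"
    and niso: "\<not> (p \<notin> Lim r \<and> q \<notin> Lim r \<and> p \<noteq> q)"
    and disj: "nbhd r (lim_down r p) a \<inter> nbhd r (lim_down r q) b = {}"
    and lt: "less_in r (lim_down r q) (lim_down r p)"
    and a: "lim_down r p \<in> Lim r \<Longrightarrow> less_in r a (lim_down r p)"
    and f1: "lim_down r p \<in> Lim r \<Longrightarrow> \<exists>c. less_in r a c \<and> less_in r c f \<and> less_in r f (lim_down r p)"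
    and f2: "lim_down r p \<notin> Lim r \<Longrightarrow> \<exists>b. covers r b p \<Longrightarrow> covers r f p"
  shows "less_in r q f \<and> less_in r f p"
proof (cases "lim_down r p \<in> Lim r")
  case True
  \<comment> \<open>The spare point \<open>c\<close> absorbs the difference between \<open>q\<close>
    and \<open>lim_down r q\<close>: with \<open>f\<close> only known to exceed \<open>a\<close>,
    the successor of \<open>a\<close> could be both \<open>q\<close> and \<open>f\<close>.\<close>
  then obtain c where c: "less_in r a c" "less_in r c f" "less_in r f (lim_down r p)" using f1 by blast
  have "lim_down r q \<notin> nbhd r (lim_down r p) a" using disj nbhd_self[of "lim_down r q" r b] by blast
  then have "\<not> less_in r a (lim_down r q)" using True lt by (simp add: nbhd_def)
  then have qc: "less_in r (lim_down r q) c"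
    using c(1) lt_linear[of a "lim_down r q"] lt_trans lt_Field a[OF True] lt by metis
  \<comment> \<open>Either \<open>q\<close> equals \<open>lim_down r q\<close> or covers it, so
    nothing above \<open>lim_down r q\<close> is below \<open>q\<close>.\<close>
  have "\<not> less_in r c q"
    by (rule lim_down_cases[of r q]) (use qc lt_asym in \<open>auto simp: covers_def\<close>)
  then have "less_in r q f" using c(2) lt_linear[OF q, of c] lt_trans lt_Field by metis
  moreover have "less_in r f p"
    by (rule lim_down_cases[of r p]) (use c(3) lt_trans[OF c(3), of p] in \<open>simp_all add: covers_def\<close>)
  ultimately show ?thesis by (rule conjI)
next
  case False
  then have dp: "lim_down r p = p" and nl: "\<And>b. covers r b p \<Longrightarrow> b \<notin> Lim r"
    by (metis lim_down_cases)+
  from False dp have pl: "p \<notin> Lim r" by simp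
  have f: "covers r f p" using f2[OF False] ex_covers[OF p pl] lt dp by metis
  then have fl: "f \<notin> Lim r" and fp: "less_in r f p" and fF: "f \<in> Field r"
    using nl lt_Field by (auto simp: covers_def)
  have qp: "less_in r (lim_down r q) p" using lt dp by simp
  have "q \<in> Lim r \<or> q = p" using niso pl by blast
  moreover have "q \<noteq> p" using qp dp by metis
  ultimately have ql: "q \<in> Lim r" by blast
  then have "less_in r q p" using qp lim_down_lim by metis
  then have "\<not> less_in r f q" using f by (auto simp: covers_def)
  moreover have "q \<noteq> f" using ql fl by blast
  ultimately show ?thesis using lt_linear[OF q fF] fp by blast
qed

text \<open>Limits are fixed and no point moves up, so the strict inequalities below limits survive.
  An isolated value of \<open>lim_down\<close> comes only from a fixed point, so no new pair of
  distinct isolated values appears.\<close>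

lemma switch_lim_down:
  assumes x: "x \<in> seqs r" and y: "y \<in> seqs r" and sw: "switch r x y"
  shows "switch r (lim_down r \<circ> x) (lim_down r \<circ> y)"
proof -
  have le: "less_in r (lim_down r p) q" if "less_in r p q" for p q
    by (rule lim_down_cases[of r p])
      (use that lt_trans[of "lim_down r p" p q] in \<open>simp_all add: covers_def\<close>)
  have fixed: "lim_down r p = p \<and> p \<notin> Lim r" if "lim_down r p \<notin> Lim r" for p
    using that by (metis lim_down_cases)
  have inf: "infinite {n. less_in r (lim_down r (x n)) (lim_down r (y n)) \<and> lim_down r (y n) \<in> Lim r}"
    if "infinite {n. less_in r (x n) (y n) \<and> y n \<in> Lim r}" for x y :: "nat \<Rightarrow> 'a"
  proof
    assume "finite {n. less_in r (lim_down r (x n)) (lim_down r (y n)) \<and> lim_down r (y n) \<in> Lim r}"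
    moreover have "{n. less_in r (x n) (y n) \<and> y n \<in> Lim r} \<subseteq>
        {n. less_in r (lim_down r (x n)) (lim_down r (y n)) \<and> lim_down r (y n) \<in> Lim r}"
    proof
      fix n assume "n \<in> {n. less_in r (x n) (y n) \<and> y n \<in> Lim r}"
      then have n: "less_in r (x n) (y n)" "y n \<in> Lim r" by simp_all
      then show "n \<in> {n. less_in r (lim_down r (x n)) (lim_down r (y n)) \<and> lim_down r (y n) \<in> Lim r}"
        using le[OF n(1)] lim_down_lim[OF n(2)] by simp
    qed
    ultimately show False using that finite_subset by blast
  qed
  have "{n. lim_down r (x n) \<in> Field r - Lim r \<and> lim_down r (y n) \<in> Field r - Lim r \<and>
        lim_down r (x n) \<noteq> lim_down r (y n)}
      \<subseteq> {n. x n \<in> Field r - Lim r \<and> y n \<in> Field r - Lim r \<and> x n \<noteq> y n}"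
    (is "?L \<subseteq> ?R")
  proof
    fix n assume n: "n \<in> ?L"
    then have "lim_down r (x n) = x n" "lim_down r (y n) = y n"
      using fixed[of "x n"] fixed[of "y n"] by simp_all
    then show "n \<in> ?R" using n by simp
  qed
  then have "finite ?L" using sw finite_subset unfolding switch_def by blast
  then show ?thesis
    unfolding switch_def comp_def using sw inf[of x y] inf[of y x] by (simp only: switch_def simp_thms)
qed

lemma halvable_imp_Delta:
  assumes "halvable (nabla r)"
  shows "Delta r"
proof -
  \<comment> \<open>\<open>T\<close> is defined on classes through some representatives;
    \<open>T_iff\<close> shows that any others give the same condition.\<close>
  define T where "T c = {eq_fin r `` {y} | x y. x \<in> c \<and> y \<in> seqs r \<and> finite {n. (y n, x n) \<notin> r}}" for c
  have T_iff: "eq_fin r `` {y} \<in> T (eq_fin r `` {x}) \<longleftrightarrow> finite {n. (y n, x n) \<notin> r}"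
    if x: "x \<in> seqs r" and y: "y \<in> seqs r" for x y
  proof
    assume "eq_fin r `` {y} \<in> T (eq_fin r `` {x})"
    then obtain y' x' where xy: "eq_fin r `` {y} = eq_fin r `` {y'} \<and>
        (x, x') \<in> eq_fin r \<and> y' \<in> seqs r \<and> finite {n. (y' n, x' n) \<notin> r}"
      unfolding T_def mem_Collect_eq Image_singleton_iff by (elim exE)
    then have "(y, y') \<in> eq_fin r" using eq_fin_class_eq_iff[OF y, of y'] by simp
    then show "finite {n. (y n, x n) \<notin> r}"
      using eq_fin_finite_cong[of y y' r x x' "\<lambda>n a b. (a, b) \<notin> r"] xy by blast
  next
    assume "finite {n. (y n, x n) \<notin> r}"
    moreover have "x \<in> eq_fin r `` {x}" using x by (simp add: eq_fin_def)
    ultimately show "eq_fin r `` {y} \<in> T (eq_fin r `` {x})" unfolding T_def using y by blast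
  qed
  have "neighbornet (nabla r) T"
    unfolding neighbornet_def
  proof (intro ballI conjI)
    fix c assume "c \<in> topspace (nabla r)"
    then obtain x where x: "x \<in> seqs r" "c = eq_fin r `` {x}" by (rule nabla_class_rep)
    show "T c \<subseteq> topspace (nabla r)"
      unfolding T_def using eq_fin_class_in_topspace by blast
    obtain g where g: "bounds r g x" using bounds_exists by blast
    \<comment> \<open>Basic neighborhoods contain only points that are almost everywhere at most
      their centre.\<close>
    have "nabla_nbhd r x g \<subseteq> T c"
    proof
      fix d assume "d \<in> nabla_nbhd r x g"
      then obtain z where z: "d = eq_fin r `` {z}" "z \<in> seq_nbhd r x g" by (auto simp: nabla_nbhd_def)
      have "{n. (z n, x n) \<notin> r} \<subseteq> {n. z n \<notin> nbhd r (x n) (g n)}"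
        using x(1) le_refl by (auto simp: nbhd_def seqs_iff)
      then have "finite {n. (z n, x n) \<notin> r}" using z by (auto simp: seq_nbhd_def dest: finite_subset)
      then show "d \<in> T c" unfolding x(2) z(1) using T_iff x(1) z(2) by (auto simp: seq_nbhd_def)
    qed
    then show "\<exists>U. openin (nabla r) U \<and> c \<in> U \<and> U \<subseteq> T c"
      using openin_nabla_nbhd[OF x(1) g] self_in_nabla_nbhd[OF x(1)] x(2) by blast
  qed
  then obtain S where S: "neighbornet (nabla r) S"
    and SI: "\<And>c d. c \<in> topspace (nabla r) \<Longrightarrow> d \<in> topspace (nabla r) \<Longrightarrow> S c \<inter> S d \<noteq> {} \<Longrightarrow>
      c \<in> T d \<or> d \<in> T c"
    using assms unfolding halvable_def by meson
  have "\<exists>g. bounds r g x \<and> nabla_nbhd r x g \<subseteq> S (eq_fin r `` {x})" if x: "x \<in> seqs r" for x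
  proof -
    obtain U where "openin (nabla r) U" "eq_fin r `` {x} \<in> U" "U \<subseteq> S (eq_fin r `` {x})"
      using S eq_fin_class_in_topspace[OF x] unfolding neighbornet_def by blast
    then show ?thesis using openin_nabla_imp_nbhd[of U x] x by blast
  qed
  then obtain h where h: "\<And>x. x \<in> seqs r \<Longrightarrow> bounds r (h x) x \<and> nabla_nbhd r x (h x) \<subseteq> S (eq_fin r `` {x})"
    by metis
  define D where "D x = lim_down r \<circ> x" for x :: "nat \<Rightarrow> 'a"
  have Ds: "D x \<in> seqs r" if "x \<in> seqs r" for x
    using that lim_down_in_Field[of "x n" r for n] by (auto simp: seqs_iff D_def)
  \<comment> \<open>These are the requirements on \<open>f\<close> in
    \<open>gap_from_disjoint\<close>, with the bound taken from the halved neighborhood of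
    \<open>D x\<close>. At the least element, any value in the field is accepted.\<close>
  define ok where "ok x n v \<longleftrightarrow> v \<in> Field r \<and>
      (D x n \<in> Lim r \<longrightarrow> (\<exists>c. less_in r (h (D x) n) c \<and> less_in r c v \<and> less_in r v (D x n))) \<and>
      (D x n \<notin> Lim r \<longrightarrow> (\<exists>b. covers r b (x n)) \<longrightarrow> covers r v (x n))" for x n v
  have "\<exists>v. ok x n v" if x: "x \<in> seqs r" for x n
  proof (cases "D x n \<in> Lim r")
    case True
    then have "less_in r (h (D x) n) (D x n)" using h[OF Ds[OF x]] by (simp add: bounds_def)
    then obtain c v where "less_in r (h (D x) n) c" "less_in r c v" "less_in r v (D x n)"
      using lim_dense[OF True] by metis
    then show ?thesis using True lt_Field unfolding ok_def by metis
  next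
    case False
    have "x n \<in> Field r" using x by (simp add: seqs_iff)
    then show ?thesis using False lt_Field unfolding ok_def covers_def by metis
  qed
  then obtain f where f: "\<And>x n. x \<in> seqs r \<Longrightarrow> ok x n (f x n)" by metis
  \<comment> \<open>If the neighborhoods met, halving would put \<open>D x\<close> almost everywhere
    at or below \<open>D y\<close>, or conversely. Since \<open>D x\<close> and \<open>D y\<close>
    still switch, both are impossible.\<close>
  have disj: "infinite {n. nbhd r (D x n) (h (D x) n) \<inter> nbhd r (D y n) (h (D y) n) = {}}"
    if x: "x \<in> seqs r" and y: "y \<in> seqs r" and sw: "switch r x y" for x y
  proof
    assume "finite {n. nbhd r (D x n) (h (D x) n) \<inter> nbhd r (D y n) (h (D y) n) = {}}"
    then have "nabla_nbhd r (D x) (h (D x)) \<inter> nabla_nbhd r (D y) (h (D y)) \<noteq> {}"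
      using nabla_nbhd_meet_iff[OF Ds[OF x] Ds[OF y]] by blast
    then have "S (eq_fin r `` {D x}) \<inter> S (eq_fin r `` {D y}) \<noteq> {}"
      using h[OF Ds[OF x]] h[OF Ds[OF y]] by blast
    then have "finite {n. (D x n, D y n) \<notin> r} \<or> finite {n. (D y n, D x n) \<notin> r}"
      using SI[OF eq_fin_class_in_topspace eq_fin_class_in_topspace, OF Ds[OF x] Ds[OF y]]
        T_iff[OF Ds[OF x] Ds[OF y]] T_iff[OF Ds[OF y] Ds[OF x]] by simp
    moreover have "{n. less_in r (D y n) (D x n) \<and> D x n \<in> Lim r} \<subseteq> {n. (D x n, D y n) \<notin> r}"
      "{n. less_in r (D x n) (D y n) \<and> D y n \<in> Lim r} \<subseteq> {n. (D y n, D x n) \<notin> r}"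
      using lt_asym by force+
    moreover have "infinite {n. less_in r (D y n) (D x n) \<and> D x n \<in> Lim r}"
      "infinite {n. less_in r (D x n) (D y n) \<and> D y n \<in> Lim r}"
      using switch_lim_down[OF x y sw] unfolding switch_def D_def by simp_all
    ultimately show False by (meson finite_subset)
  qed
  have main: "infinite {n. less_in r (y n) (f x n) \<and> less_in r (f x n) (x n)} \<or>
      infinite {n. less_in r (x n) (f y n) \<and> less_in r (f y n) (y n)}" (is "infinite ?A \<or> infinite ?B")
    if x: "x \<in> seqs r" and y: "y \<in> seqs r" and sw: "switch r x y" for x y
  proof (rule ccontr)
    let ?N = "{n. x n \<in> Field r - Lim r \<and> y n \<in> Field r - Lim r \<and> x n \<noteq> y n}"
    assume "\<not> (infinite ?A \<or> infinite ?B)"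
    then have "finite (?A \<union> ?B \<union> ?N)" using sw by (simp add: switch_def)
    \<comment> \<open>Outside the finite set \<open>?N\<close> of distinct isolated values,
      \<open>gap_from_disjoint\<close> places each coordinate with disjoint neighborhoods in
      \<open>?A\<close> or \<open>?B\<close>, according to which lowered value is larger.\<close>
    moreover have "{n. nbhd r (D x n) (h (D x) n) \<inter> nbhd r (D y n) (h (D y) n) = {}} \<subseteq> ?A \<union> ?B \<union> ?N"
    proof
      fix n assume "n \<in> {n. nbhd r (D x n) (h (D x) n) \<inter> nbhd r (D y n) (h (D y) n) = {}}"
      then have dj: "nbhd r (D x n) (h (D x) n) \<inter> nbhd r (D y n) (h (D y) n) = {}" by blast
      have F: "x n \<in> Field r" "y n \<in> Field r" "D x n \<in> Field r" "D y n \<in> Field r"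
        using x y Ds by (simp_all add: seqs_iff)
      have hb: "D z n \<in> Lim r \<Longrightarrow> less_in r (h (D z) n) (D z n)" if "z \<in> seqs r" for z
        using h[OF Ds[OF that]] by (simp add: bounds_def)
      have D: "D z n = lim_down r (z n)" for z by (simp add: D_def)
      have ne: "D x n \<noteq> D y n" using dj nbhd_self by (metis disjoint_iff)
      show "n \<in> ?A \<union> ?B \<union> ?N"
      proof (cases "n \<in> ?N")
        case False
        then have niso: "\<not> (x n \<notin> Lim r \<and> y n \<notin> Lim r \<and> x n \<noteq> y n)"
          "\<not> (y n \<notin> Lim r \<and> x n \<notin> Lim r \<and> y n \<noteq> x n)" using F by auto
        from ne F consider "less_in r (D y n) (D x n)" | "less_in r (D x n) (D y n)"
          using lt_linear by blast
        then show ?thesis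
        proof cases
          case 1
          have "less_in r (y n) (f x n) \<and> less_in r (f x n) (x n)"
            by (rule gap_from_disjoint[OF F(1,2) niso(1), of "h (D x) n" "h (D y) n"])
              (use dj 1 hb[OF x] f[OF x, of n] in \<open>auto simp: ok_def D\<close>)
          then show ?thesis by blast
        next
          case 2
          have "less_in r (x n) (f y n) \<and> less_in r (f y n) (y n)"
            by (rule gap_from_disjoint[OF F(2,1) niso(2), of "h (D y) n" "h (D x) n"])
              (use dj 2 hb[OF y] f[OF y, of n] in \<open>auto simp: ok_def D\<close>)
          then show ?thesis by blast
        qed
      qed simp
    qed
    ultimately show False using disj[OF x y sw] finite_subset by blast
  qed
  \<comment> \<open>So far \<open>f\<close> depends on the sequence. Evaluating it at chosen
    representatives gives a function of classes, and finite changes of \<open>x\<close> and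
    \<open>y\<close> affect neither \<open>switch\<close> nor the infinite sets in the
    conclusion.\<close>
  obtain \<rho> where \<rho>: "\<And>c. c \<in> topspace (nabla r) \<Longrightarrow> \<rho> c \<in> seqs r \<and> c = eq_fin r `` {\<rho> c}"
    by (rule nabla_reps) blast
  show ?thesis
    unfolding Delta_def
  proof (intro exI[of _ "\<lambda>c. f (\<rho> c)"] conjI ballI impI)
    show "(\<lambda>c. f (\<rho> c)) \<in> topspace (nabla r) \<rightarrow> seqs r"
      using \<rho> f by (auto simp: seqs_iff ok_def)
  next
    fix x y assume x: "x \<in> seqs r" and y: "y \<in> seqs r" and sw: "switch r x y"
    let ?x = "\<rho> (eq_fin r `` {x})" and ?y = "\<rho> (eq_fin r `` {y})"
    have X: "?x \<in> seqs r" "?y \<in> seqs r" "(x, ?x) \<in> eq_fin r" "(y, ?y) \<in> eq_fin r"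
      using \<rho> eq_fin_class_in_topspace x y eq_fin_class_eq_iff by metis+
    then have "switch r ?x ?y" using sw switch_cong by metis
    note m = main[OF X(1,2) this]
    note cong = eq_fin_finite_cong[OF X(3,4)]
    show "infinite {n. less_in r (y n) (f ?x n) \<and> less_in r (f ?x n) (x n)} \<or>
        infinite {n. less_in r (x n) (f ?y n) \<and> less_in r (f ?y n) (y n)}"
      using m cong[of "\<lambda>n a b. less_in r b (f ?x n) \<and> less_in r (f ?x n) a"]
        cong[of "\<lambda>n a b. less_in r a (f ?y n) \<and> less_in r (f ?y n) b"] by blast
  qed
qed

end

theorem proposition30:
  fixes r :: "'a rel"
  assumes "Well_order r"
  shows "(Delta r \<longleftrightarrow> halvable (nabla r)) \<and>
         (halvable (nabla r) \<longleftrightarrow> monotonically_normal (nabla r))"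
  using Delta_imp_monotonically_normal[OF assms] halvable_imp_Delta[OF assms]
    monotonically_normal_imp_halvable by blast

end
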